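(* Every $5$-potent ring is commutative; that is, if $R$ is a ring with $x^5=x$ for all $x\in R$, then $R$ is commutative.
   Context: Rings are associative but are not assumed to have a unity. For an integer $n\geq 2$, a ring $R$ is called $n$-potent if $x^n=x$ for all $x\in R$. *)

theory Defs
  imports Main
begin

text \<open>The class \<open>ring\<close> is that of associative rings without a unity, so the library's
  power operation, which needs \<open>1\<close>, is not available. The following is
  the usual \<open>n\<close>-fold product \<open>x * ... * x\<close> for \<open>n \<ge> 1\<close>; its value at
  \<open>n = 0\<close> is \<open>x\<close> and has no meaning.\<close>

definition pos_power :: "'a::semigroup_mult \<Rightarrow> nat \<Rightarrow> 'a" where
  "pos_power x n = (((*) x) ^^ (n - 1)) x"

lemma pos_power_1: "pos_power x 1 = x"
  by (simp add: pos_power_def)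

lemma pos_power_Suc: "n \<ge> 1 \<Longrightarrow> pos_power x (Suc n) = x * pos_power x n"
  by (cases n) (simp_all add: pos_power_def)

lemma pos_power_eq_power: "n \<ge> 1 \<Longrightarrow> pos_power (x::'a::monoid_mult) n = x ^ n"
  by (induction n rule: dec_induct) (simp_all add: pos_power_1[simplified] pos_power_Suc)

definition potent_ring :: "nat \<Rightarrow> 'a::ring itself \<Rightarrow> bool" where
  "potent_ring n R \<longleftrightarrow> n \<ge> 2 \<and> (\<forall>x::'a. pos_power x n = x)"

end

theory Submission
  imports Defs
begin

text \<open>Expanding \<open>(x + x)^5\<close> gives \<open>30 x = 0\<close>, and expanding \<open>(x \<plusminus> x\<^sup>2)^5\<close> gives
  \<open>10 x\<^sup>3 = 10 x\<close> and \<open>15 x\<^sup>2 = 15 x\<close>. Now linearize these identities together with \<open>x^5 = x\<close>.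
  The part of \<open>(x + y)^p\<close> that is linear in \<open>y\<close> is
  \<open>s = \<Sum> x^i y x^(p - 1 - i)\<close>, and \<open>x s - s x = x^p y - y x^p\<close> telescopes.
  Isolating \<open>s\<close> by substituting \<open>-y\<close> and \<open>2 y\<close> for \<open>y\<close> kills \<open>12 (x y - y x)\<close> for \<open>p = 5\<close>,
  \<open>20 (x y - y x)\<close> for \<open>p = 3\<close>, and \<open>15 (x y - y x)\<close> for \<open>p = 2\<close>.
  Since \<open>36 - 20 - 15 = 1\<close>, the commutator vanishes.\<close>

text \<open>Multiples are taken in the additive group, as without a unity n need not stand for a
  ring element.\<close>

primrec nmul :: "nat \<Rightarrow> 'a::ring \<Rightarrow> 'a" where
  "nmul 0 x = 0"
| "nmul (Suc n) x = x + nmul n x"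

lemma nmul_zero [simp]: "nmul n 0 = 0"
  by (induction n) simp_all

lemma nmul_add: "nmul n (x + y) = nmul n x + nmul n y"
  by (induction n) (simp_all add: algebra_simps)

lemma nmul_minus: "nmul n (- x) = - nmul n x"
  by (induction n) simp_all

lemma nmul_diff: "nmul n (x - y) = nmul n x - nmul n y"
  using nmul_add[of n x "- y"] by (simp add: nmul_minus)

lemma nmul_add_left: "nmul (m + n) x = nmul m x + nmul n x"
  by (induction m) (simp_all add: algebra_simps)

lemma nmul_mult_left: "nmul n x * y = nmul n (x * y)"
  by (induction n) (simp_all add: algebra_simps)

lemma nmul_mult_right: "x * nmul n y = nmul n (x * y)"
  by (induction n) (simp_all add: algebra_simps)

lemma nmul_mult: "nmul (m * n) x = nmul m (nmul n x)"
  by (induction m) (simp_all add: nmul_add_left)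

lemma nmul_eq_0_mult: "nmul n x = 0 \<Longrightarrow> nmul (m * n) x = 0"
  by (simp add: nmul_mult)

lemma pos_power_5: "pos_power x 5 = x * (x * (x * (x * x)))"
  by (simp add: pos_power_def numeral_eq_Suc)

context
  assumes fifth: "\<And>x::'a::ring. x * (x * (x * (x * x))) = x"
begin

text \<open>Needed for rewriting: in a right-nested product, \<open>fifth\<close> does not match x^5
  followed by further factors.\<close>

lemma fifth': "x * (x * (x * (x * (x * y)))) = x * (y::'a)"
  by (metis fifth mult.assoc)

lemma nmul_30: "nmul 30 (x::'a) = 0"
  using fifth[of "x + x"] by (simp add: numeral_eq_Suc algebra_simps fifth)

lemma fifth_linearized: "nmul 12 (x * y) = nmul 12 (y * (x::'a))"
proof -
  \<comment> \<open>In (x + y)^5, \<open>A x y\<close> and \<open>B x y\<close> are the parts of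
    degree 1 and 2 in y; \<open>B y x\<close> and \<open>A y x\<close> are those of degree 3 and
    4.\<close>
  define A where "A = (\<lambda>x y::'a. y*(x*(x*(x*x))) + x*(y*(x*(x*x))) + x*(x*(y*(x*x)))
    + x*(x*(x*(y*x))) + x*(x*(x*(x*y))))"
  define B where "B = (\<lambda>x y::'a. y*(y*(x*(x*x))) + y*(x*(y*(x*x))) + y*(x*(x*(y*x)))
    + y*(x*(x*(x*y))) + x*(y*(y*(x*x))) + x*(y*(x*(y*x))) + x*(y*(x*(x*y)))
    + x*(x*(y*(y*x))) + x*(x*(y*(x*y))) + x*(x*(x*(y*y))))"
  have sum: "A x y + B x y + B y x + A y x = 0" for y
  proof -
    have "(x+y)*((x+y)*((x+y)*((x+y)*(x+y)))) = x + y + (A x y + B x y + B y x + A y x)"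
      by (simp add: algebra_simps A_def B_def fifth)
    then show ?thesis by (simp add: fifth)
  qed
  have A_minus: "A x (- y) = - A x y" "A (- y) x = A y x"
    and B_minus: "B x (- y) = B x y" "B (- y) x = - B y x" for y
    by (simp_all add: A_def B_def algebra_simps)
  \<comment> \<open>Subtracting the identity at -y cancels the even degrees in y and doubles the odd
    ones.\<close>
  have odd: "nmul 2 (A x y + B y x) = 0" for y
  proof -
    have "nmul 2 (A x y + B y x) = (A x y + B x y + B y x + A y x)
        - (A x (- y) + B x (- y) + B (- y) x + A (- y) x)"
      unfolding A_minus B_minus by (simp add: numeral_eq_Suc algebra_simps)
    then show ?thesis by (simp only: sum diff_self)
  qed
  \<comment> \<open>Doubling y scales degree 1 by 2 and degree 3 by 8; comparing with 8 times
    \<open>odd\<close> removes degree 3 and leaves 16 - 4 = 12.\<close>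
  have "A x (y + y) = nmul 2 (A x y)" "B (y + y) x = nmul 8 (B y x)"
    by (simp_all add: A_def B_def algebra_simps numeral_eq_Suc)
  with odd[of "y + y"] have "nmul 4 (A x y) + nmul 16 (B y x) = 0"
    by (simp add: nmul_add flip: nmul_mult)
  moreover have "nmul 16 (A x y) + nmul 16 (B y x) = 0"
    using nmul_eq_0_mult[OF odd[of y], of 8] by (simp add: nmul_add)
  ultimately have "nmul 12 (A x y) = 0"
    using nmul_add_left[of 12 4 "A x y"] by (simp add: add.assoc)
  then have "nmul 12 (x * A x y - A x y * x) = 0"
    by (metis nmul_diff nmul_mult_left nmul_mult_right mult_zero_left mult_zero_right diff_self)
  moreover have "x * A x y - A x y * x = x * y - y * x"
    by (simp add: A_def algebra_simps fifth fifth')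
  ultimately show ?thesis by (simp add: nmul_diff)
qed

text \<open>Since x and x^2 commute, the binomial theorem applies; x^5 = x reduces the exponents 6,
  ..., 10 to 2, 3, 4, 1, 2.\<close>

lemma square_plus_cube:
  "nmul 5 x + nmul 5 (x * x) + nmul 10 (x * (x * x)) + nmul 10 (x * (x * (x * x))) = (0::'a)"
  using fifth[of "x + x * x"]
  by (simp add: numeral_eq_Suc algebra_simps fifth fifth')

lemma nmul_10_cube: "nmul 10 (x * (x * x)) = nmul 10 (x::'a)"
proof -
  have "(nmul 5 x + nmul 10 (x * (x * x))) + (nmul 5 (x * x) + nmul 10 (x * (x * (x * x)))) = 0"
    using square_plus_cube[of x] by (simp add: algebra_simps)
  \<comment> \<open>Passing to -x shows that the odd and even parts agree, so twice the odd part
    vanishes.\<close>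
  moreover have "nmul 5 (x * x) + nmul 10 (x * (x * (x * x))) = nmul 5 x + nmul 10 (x * (x * x))"
    using square_plus_cube[of "- x"] by (simp add: nmul_minus algebra_simps)
  ultimately have "nmul 10 x + nmul 20 (x * (x * x)) = 0"
    using nmul_add_left[of 5 5 x] nmul_add_left[of 10 10 "x * (x * x)"]
    by (simp add: algebra_simps)
  moreover have "nmul 10 (x * (x * x)) + nmul 20 (x * (x * x)) = 0"
    using nmul_30[of "x * (x * x)"] by (simp flip: nmul_add_left)
  ultimately show ?thesis by (metis add_right_cancel)
qed

lemma nmul_15_square: "nmul 15 (x * x) = nmul 15 (x::'a)"
proof -
  have "nmul 10 (x * (x * (x * x))) = nmul 10 (x * x)"
    by (metis nmul_10_cube nmul_mult_right)
  then have "nmul 15 x + nmul 15 (x * x) = 0"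
    using square_plus_cube[of x] nmul_add_left[of 5 10 x] nmul_add_left[of 5 10 "x * x"]
    by (simp add: nmul_10_cube algebra_simps)
  \<comment> \<open>By 30 x = 0, 15 x is its own negative, which turns the vanishing sum into an
    equality.\<close>
  moreover have "nmul 15 x + nmul 15 x = 0"
    using nmul_30[of x] by (simp flip: nmul_add_left)
  ultimately show ?thesis by (metis add_left_cancel)
qed

lemma cube_linearized: "nmul 20 (x * y) = nmul 20 (y * (x::'a))"
proof -
  define T where "T = (\<lambda>x y::'a. y*(x*x) + x*(y*x) + x*(x*y))"
  have sum: "nmul 10 (T x y + T y x) = 0" for y
  proof -
    have "(x+y)*((x+y)*(x+y)) = x*(x*x) + y*(y*y) + (T x y + T y x)"
      by (simp add: algebra_simps T_def)
    then have "nmul 10 (x + y) = nmul 10 (x + y) + nmul 10 (T x y + T y x)"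
      by (metis nmul_10_cube nmul_add)
    then show ?thesis by simp
  qed
  \<comment> \<open>Only \<open>T x y\<close> is odd in y, so the sign change alone isolates it,
    with factor 2 * 10.\<close>
  have "T x (- y) = - T x y" "T (- y) x = T y x"
    by (simp_all add: T_def algebra_simps)
  then have "nmul 20 (T x y) = 0"
    using sum[of y] sum[of "- y"] nmul_add_left[of 10 10 "T x y"]
    by (simp add: nmul_add nmul_diff nmul_minus)
  then have "nmul 20 (x * T x y - T x y * x) = 0"
    by (metis nmul_diff nmul_mult_left nmul_mult_right mult_zero_left mult_zero_right diff_self)
  moreover have "x * T x y - T x y * x = x*(x*x) * y - y * (x*(x*x))"
    by (simp add: T_def algebra_simps)
  moreover have "nmul 20 (x*(x*x)) = nmul 20 x"
    using nmul_mult[of 2 10 "x*(x*x)"] nmul_mult[of 2 10 x] by (simp add: nmul_10_cube)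
  ultimately show ?thesis
    by (metis nmul_diff nmul_mult_left nmul_mult_right eq_iff_diff_eq_0)
qed

lemma square_linearized: "nmul 15 (x * y) = nmul 15 (y * (x::'a))"
proof -
  have "nmul 15 (x * y) + nmul 15 (y * x) = 0"
    using nmul_15_square[of "x + y"]
    by (simp add: algebra_simps nmul_add nmul_15_square)
  moreover have "nmul 15 (y * x) + nmul 15 (y * x) = 0"
    using nmul_30[of "y * x"] by (simp flip: nmul_add_left)
  ultimately show ?thesis by (metis add_right_cancel)
qed

lemma fifth_power_commute: "x * y = y * (x::'a)"
proof -
  have "nmul 36 (x * y - y * x) = 0"
    using nmul_mult[of 3 12 "x * y - y * x"] by (simp add: nmul_diff fifth_linearized[of x y])
  moreover have "nmul 20 (x * y - y * x) = 0" "nmul 15 (x * y - y * x) = 0"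
    using cube_linearized[of x y] square_linearized[of x y] by (simp_all add: nmul_diff)
  moreover have "nmul 36 z = z + nmul 20 z + nmul 15 z" for z :: 'a
    using nmul_add_left[of 20 15 z] nmul.simps(2)[of 35 z] by (simp add: add.assoc)
  ultimately show ?thesis by simp
qed

end

theorem theorem2p12:
  assumes "potent_ring 5 TYPE('a::ring)"
  shows "\<forall>x y :: 'a. x * y = y * x"
  using assms fifth_power_commute unfolding potent_ring_def pos_power_5 by blast

end
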